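(* Let $\gamma(s)$ be a partially null curve in $E_1^4$ with Frenet vector fields $F_1,F_2,F_3,F_4$. The tubular hypersurfaces that are formed as the envelope of a family of pseudo hyperspheres of constant radius $r$ whose centers lie on $\gamma(s)$ can be parametrized by $$T_1(s,t,w)=\gamma(s)\mp r\left(\sin f\,F_2(s)+g\cos f\,F_3(s)+\frac{\cos f}{2g}F_4(s)\right),$$ $$T_2(s,t,w)=\gamma(s)\mp r\left(\cos f\,F_2(s)+g\sin f\,F_3(s)+\frac{\sin f}{2g}F_4(s)\right),$$ $$T_3(s,t,w)=\gamma(s)\mp r\left(\cosh f\,F_2(s)+g\sinh f\,F_3(s)-\frac{\sinh f}{2g}F_4(s)\right).$$ Furthermore, the tubular hypersurfaces that are formed as the envelope of a family of pseudo hyperbolic hyperspheres of constant radius $r$ whose centers lie on $\gamma(s)$ can be parametrized by $$T_4(s,t,w)=\gamma(s)\mp r\left(\sinh f\,F_2(s)+g\cosh f\,F_3(s)-\frac{\cosh f}{2g}F_4(s)\right).$$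
   Context: $E_1^4$ is $\mathbb{R}^4$ with $\langle u,v\rangle=-u_1v_1+u_2v_2+u_3v_3+u_4v_4$. A partially null curve is a unit speed spacelike curve $\gamma(s)$ whose binormal is null; it has a Frenet frame $F_1=\gamma',F_2,F_3,F_4$ with $\langle F_1,F_1\rangle=\langle F_2,F_2\rangle=\langle F_3,F_4\rangle=1$, all other products $\langle F_i,F_j\rangle$ zero, and $F_1'=k_1F_2$, $F_2'=-k_1F_1+k_2F_3$, $F_3'=k_3F_3$, $F_4'=-k_2F_2-k_3F_4$, where $k_3=0$ for all $s$. The pseudo hypersphere (resp. pseudo hyperbolic hypersphere) with center $p$ and radius $r>0$ is $\{u:\langle u-p,u-p\rangle=r^2\}$ (resp. $\{u:\langle u-p,u-p\rangle=-r^2\}$). With $\lambda=1$ for pseudo hyperspheres and $\lambda=-1$ for pseudo hyperbolic hyperspheres, a hypersurface $T(s,t,w)$ is (formed as) the envelope of the family with centers $\gamma(s)$ and constant radius $r>0$ (a tubular hypersurface) if $\langle T-\gamma,T-\gamma\rangle=\lambda r^2$ and $T(s,t,w)-\gamma(s)$ is normal to the hypersurface (in particular $\langle T-\gamma,\partial T/\partial s\rangle=0$). $f=f(t,w)$ and $g=g(t,w)$ are smooth real functions with $g$ nowhere zero; $\mp$ means either sign may be chosen.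
   Formalization: That every tubular hypersurface of pseudo hyperspheres has form T1, T2 or T3 is shown only where the F3 and F4 coefficients of T−γ have nonzero product (positive: T1, T2; negative, connected domain: T3), as points like γ+r(F2+F3) lie on none of them. *)

theory Defs
  imports "HOL-Analysis.Analysis"
begin

definition lprod :: "real ^ 4 \<Rightarrow> real ^ 4 \<Rightarrow> real" where
  "lprod u v = - (u $ 1 * v $ 1) + u $ 2 * v $ 2 + u $ 3 * v $ 3 + u $ 4 * v $ 4"

(* Class C^k and C^infinity, intended for open S. *)
fun Ck_on :: "nat \<Rightarrow> 'a::euclidean_space set \<Rightarrow> ('a \<Rightarrow> 'b::real_normed_vector) \<Rightarrow> bool" where
  "Ck_on 0 S f \<longleftrightarrow> continuous_on S f"
| "Ck_on (Suc k) S f \<longleftrightarrow>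
     (\<forall>x\<in>S. f differentiable (at x)) \<and> (\<forall>v. Ck_on k S (\<lambda>x. frechet_derivative f (at x) v))"

definition smooth_on :: "'a::euclidean_space set \<Rightarrow> ('a \<Rightarrow> 'b::real_normed_vector) \<Rightarrow> bool" where
  "smooth_on S f \<longleftrightarrow> (\<forall>k. Ck_on k S f)"

(* A partially null curve on the open interval I, together with its Frenet frame and its
   curvature functions.  That the curve is spacelike and has unit speed is contained in
   "gamma' = F1" and "lprod F1 F1 = 1"; that the binormal F3 is null is "lprod F3 F3 = 0". *)
definition partially_null_curve ::
  "real set \<Rightarrow> (real \<Rightarrow> real ^ 4) \<Rightarrow>
   (real \<Rightarrow> real ^ 4) \<Rightarrow> (real \<Rightarrow> real ^ 4) \<Rightarrow> (real \<Rightarrow> real ^ 4) \<Rightarrow> (real \<Rightarrow> real ^ 4) \<Rightarrow>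
   (real \<Rightarrow> real) \<Rightarrow> (real \<Rightarrow> real) \<Rightarrow> (real \<Rightarrow> real) \<Rightarrow> bool" where
  "partially_null_curve I \<gamma> F1 F2 F3 F4 k1 k2 k3 \<longleftrightarrow>
     open I \<and> is_interval I \<and> I \<noteq> {} \<and>
     smooth_on I \<gamma> \<and>
     smooth_on I F1 \<and> smooth_on I F2 \<and> smooth_on I F3 \<and> smooth_on I F4 \<and>
     smooth_on I k1 \<and> smooth_on I k2 \<and> smooth_on I k3 \<and>
     (\<forall>s\<in>I.
        lprod (F1 s) (F1 s) = 1 \<and> lprod (F2 s) (F2 s) = 1 \<and> lprod (F3 s) (F4 s) = 1 \<and>
        lprod (F3 s) (F3 s) = 0 \<and> lprod (F4 s) (F4 s) = 0 \<and>
        lprod (F1 s) (F2 s) = 0 \<and> lprod (F1 s) (F3 s) = 0 \<and> lprod (F1 s) (F4 s) = 0 \<and>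
        lprod (F2 s) (F3 s) = 0 \<and> lprod (F2 s) (F4 s) = 0 \<and>
        (\<gamma> has_vector_derivative F1 s) (at s) \<and>
        (F1 has_vector_derivative k1 s *\<^sub>R F2 s) (at s) \<and>
        (F2 has_vector_derivative - k1 s *\<^sub>R F1 s + k2 s *\<^sub>R F3 s) (at s) \<and>
        (F3 has_vector_derivative k3 s *\<^sub>R F3 s) (at s) \<and>
        (F4 has_vector_derivative - k2 s *\<^sub>R F2 s - k3 s *\<^sub>R F4 s) (at s) \<and>
        k3 s = 0)"

definition pseudo_hypersphere :: "real ^ 4 \<Rightarrow> real \<Rightarrow> (real ^ 4) set" where
  "pseudo_hypersphere p r = {u. lprod (u - p) (u - p) = r\<^sup>2}"

definition pseudo_hyperbolic_hypersphere :: "real ^ 4 \<Rightarrow> real \<Rightarrow> (real ^ 4) set" where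
  "pseudo_hyperbolic_hypersphere p r = {u. lprod (u - p) (u - p) = - r\<^sup>2}"

(* T, with parameter domain U, is a tubular hypersurface: the envelope of the family Q (gamma s) r,
   where Q p r is one of the two kinds of hyperspheres with center p and radius r.
   T - gamma is normal to the hypersurface, i.e. orthogonal to all three coordinate tangents.
   T is not required to be an immersion: the coefficient functions below are arbitrary and
   may for instance be constant. *)
definition tubular_hypersurface ::
  "(real ^ 4 \<Rightarrow> real \<Rightarrow> (real ^ 4) set) \<Rightarrow> real set \<Rightarrow> (real \<Rightarrow> real ^ 4) \<Rightarrow> real \<Rightarrow>
   (real \<times> real \<times> real) set \<Rightarrow> (real \<times> real \<times> real \<Rightarrow> real ^ 4) \<Rightarrow> bool" where
  "tubular_hypersurface Q I \<gamma> r U T \<longleftrightarrow>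
     open U \<and> U \<subseteq> I \<times> UNIV \<and> smooth_on U T \<and>
     (\<forall>(s, t, w)\<in>U.
        T (s, t, w) \<in> Q (\<gamma> s) r \<and>
        lprod (T (s, t, w) - \<gamma> s) (vector_derivative (\<lambda>x. T (x, t, w)) (at s)) = 0 \<and>
        lprod (T (s, t, w) - \<gamma> s) (vector_derivative (\<lambda>x. T (s, x, w)) (at t)) = 0 \<and>
        lprod (T (s, t, w) - \<gamma> s) (vector_derivative (\<lambda>x. T (s, t, x)) (at w)) = 0)"

definition coefficient_functions ::
  "(real \<times> real) set \<Rightarrow> (real \<times> real \<Rightarrow> real) \<Rightarrow> (real \<times> real \<Rightarrow> real) \<Rightarrow> bool" where
  "coefficient_functions D f g \<longleftrightarrow>
     open D \<and> smooth_on D f \<and> smooth_on D g \<and> (\<forall>x\<in>D. g x \<noteq> 0)"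

(* In the following four maps \<sigma> is 1 or -1 and stands for the free choice of sign. *)

definition T1 ::
  "(real \<Rightarrow> real ^ 4) \<Rightarrow> (real \<Rightarrow> real ^ 4) \<Rightarrow> (real \<Rightarrow> real ^ 4) \<Rightarrow> (real \<Rightarrow> real ^ 4) \<Rightarrow> real \<Rightarrow>
   real \<Rightarrow> (real \<times> real \<Rightarrow> real) \<Rightarrow> (real \<times> real \<Rightarrow> real) \<Rightarrow> real \<times> real \<times> real \<Rightarrow> real ^ 4" where
  "T1 \<gamma> F2 F3 F4 r \<sigma> f g = (\<lambda>(s, t, w).
     \<gamma> s + (\<sigma> * r) *\<^sub>R (sin (f (t, w)) *\<^sub>R F2 s + (g (t, w) * cos (f (t, w))) *\<^sub>R F3 s
       + (cos (f (t, w)) / (2 * g (t, w))) *\<^sub>R F4 s))"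

definition T2 ::
  "(real \<Rightarrow> real ^ 4) \<Rightarrow> (real \<Rightarrow> real ^ 4) \<Rightarrow> (real \<Rightarrow> real ^ 4) \<Rightarrow> (real \<Rightarrow> real ^ 4) \<Rightarrow> real \<Rightarrow>
   real \<Rightarrow> (real \<times> real \<Rightarrow> real) \<Rightarrow> (real \<times> real \<Rightarrow> real) \<Rightarrow> real \<times> real \<times> real \<Rightarrow> real ^ 4" where
  "T2 \<gamma> F2 F3 F4 r \<sigma> f g = (\<lambda>(s, t, w).
     \<gamma> s + (\<sigma> * r) *\<^sub>R (cos (f (t, w)) *\<^sub>R F2 s + (g (t, w) * sin (f (t, w))) *\<^sub>R F3 s
       + (sin (f (t, w)) / (2 * g (t, w))) *\<^sub>R F4 s))"

definition T3 ::
  "(real \<Rightarrow> real ^ 4) \<Rightarrow> (real \<Rightarrow> real ^ 4) \<Rightarrow> (real \<Rightarrow> real ^ 4) \<Rightarrow> (real \<Rightarrow> real ^ 4) \<Rightarrow> real \<Rightarrow>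
   real \<Rightarrow> (real \<times> real \<Rightarrow> real) \<Rightarrow> (real \<times> real \<Rightarrow> real) \<Rightarrow> real \<times> real \<times> real \<Rightarrow> real ^ 4" where
  "T3 \<gamma> F2 F3 F4 r \<sigma> f g = (\<lambda>(s, t, w).
     \<gamma> s + (\<sigma> * r) *\<^sub>R (cosh (f (t, w)) *\<^sub>R F2 s + (g (t, w) * sinh (f (t, w))) *\<^sub>R F3 s
       - (sinh (f (t, w)) / (2 * g (t, w))) *\<^sub>R F4 s))"

definition T4 ::
  "(real \<Rightarrow> real ^ 4) \<Rightarrow> (real \<Rightarrow> real ^ 4) \<Rightarrow> (real \<Rightarrow> real ^ 4) \<Rightarrow> (real \<Rightarrow> real ^ 4) \<Rightarrow> real \<Rightarrow>
   real \<Rightarrow> (real \<times> real \<Rightarrow> real) \<Rightarrow> (real \<times> real \<Rightarrow> real) \<Rightarrow> real \<times> real \<times> real \<Rightarrow> real ^ 4" where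
  "T4 \<gamma> F2 F3 F4 r \<sigma> f g = (\<lambda>(s, t, w).
     \<gamma> s + (\<sigma> * r) *\<^sub>R (sinh (f (t, w)) *\<^sub>R F2 s + (g (t, w) * cosh (f (t, w))) *\<^sub>R F3 s
       - (cosh (f (t, w)) / (2 * g (t, w))) *\<^sub>R F4 s))"

(* The hypersurface T on U is parametrized by a member of the family P after a smooth change of
   the parameters (t, w), which may depend on s.  The change of parameters is needed because f and g
   do not depend on s.  If T is an immersion, the equation forces (s, t, w) \<mapsto> (s, \<phi> (s, t, w)) to be
   a local diffeomorphism. *)
definition parametrized_by ::
  "(real \<times> real \<times> real) set \<Rightarrow> (real \<times> real \<times> real \<Rightarrow> real ^ 4) \<Rightarrow>
   (real \<Rightarrow> (real \<times> real \<Rightarrow> real) \<Rightarrow> (real \<times> real \<Rightarrow> real) \<Rightarrow> real \<times> real \<times> real \<Rightarrow> real ^ 4) \<Rightarrow> bool"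
where
  "parametrized_by U T P \<longleftrightarrow>
     (\<exists>\<sigma> D f g \<phi>. \<sigma> \<in> {1, - 1} \<and> coefficient_functions D f g \<and>
        smooth_on U \<phi> \<and> \<phi> ` U \<subseteq> D \<and>
        (\<forall>(s, t, w)\<in>U. T (s, t, w) = P \<sigma> f g (s, \<phi> (s, t, w))))"

end

theory Submission imports Defs begin

text \<open>
Let \<open>T\<close> be a map whose points \<open>T (s, t, w)\<close> lie on the hypersphere of type \<open>\<kappa> = \<plusminus>1\<close> and radius \<open>r\<close>
around \<open>\<gamma> s\<close>, that is, \<open>\<langle>T - \<gamma>, T - \<gamma>\<rangle> = \<kappa> r\<^sup>2\<close>. Differentiating this equation shows that \<open>T - \<gamma>\<close> is
orthogonal to the \<open>t\<close>- and \<open>w\<close>-tangents, and that its product with the \<open>s\<close>-tangent equals its product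
with \<open>\<gamma>' = F1\<close>. So \<open>T\<close> is tubular if and only if \<open>T - \<gamma>\<close> is orthogonal to \<open>F1\<close>
(\<open>tubular_hypersurface_iff_normal_plane\<close>). In the frame this reads \<open>T - \<gamma> = r (a F2 + b F3 + c F4)\<close>
with \<open>a\<^sup>2 + 2 b c = \<kappa>\<close>, so the theorem is about parametrizations of a quadric in three-space.

The four families are the points \<open>a = A (f)\<close>, \<open>b = g B (f)\<close>, \<open>c = \<epsilon> B (f) / (2 g)\<close> of this quadric,
up to a common sign, where \<open>A\<^sup>2 + \<epsilon> B\<^sup>2 = \<kappa>\<close>; this gives the first claim (\<open>frame_tube_tubular\<close>).

Conversely, for coefficients \<open>a\<close>, \<open>b\<close> of a given tubular hypersurface, one solves \<open>A (f) = \<sigma> a\<close> by a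
smooth inverse of \<open>A\<close> and puts \<open>g = \<sigma> b / B (f)\<close>; the equation of the quadric takes care of \<open>c\<close>
(\<open>tubular_parametrized_by_frame_tube\<close>). This requires \<open>b \<noteq> 0\<close>, \<open>B (f) \<noteq> 0\<close> and \<open>\<sigma> a\<close> in the domain
of the inverse:

  \<^item> if \<open>\<kappa> = 1\<close> and \<open>b c > 0\<close>, then \<open>\<bar>a\<bar> < 1\<close>, and \<open>arcsin\<close> or \<open>arccos\<close> applies;
  \<^item> if \<open>\<kappa> = 1\<close> and \<open>b c < 0\<close>, then \<open>\<bar>a\<bar> > 1\<close>, and \<open>arcosh\<close> applies once the sign \<open>\<sigma>\<close> of \<open>a\<close> is known
    to be the same everywhere, which connectedness provides;
  \<^item> if \<open>\<kappa> = - 1\<close>, then \<open>2 b c = - 1 - a\<^sup>2 < 0\<close> holds at every point, and \<open>arsinh\<close> applies globally.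

The remaining work is a calculus for \<^const>\<open>smooth_on\<close>: closure under sums, bilinear products, pairs and
composition, and smoothness of the elementary functions involved.
\<close>

section \<open>Calculus of smooth functions\<close>

lemma Ck_on_cong:
  assumes "open S" "\<And>x. x \<in> S \<Longrightarrow> f x = g x" "Ck_on k S f"
  shows "Ck_on k S g"
  using assms
proof (induction k arbitrary: f g)
  case 0
  then show ?case by (simp cong: continuous_on_cong)
next
  case (Suc k)
  have der: "(g has_derivative frechet_derivative f (at x)) (at x)" if "x \<in> S" for x
  proof -
    have "(f has_derivative frechet_derivative f (at x)) (at x)"
      using Suc.prems(3) that by (simp add: frechet_derivative_works)
    then show ?thesis
      using has_derivative_transform_within_open Suc.prems(1,2) that by blast
  qed
  have "Ck_on k S (\<lambda>x. frechet_derivative g (at x) v)" for v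
  proof (rule Suc.IH)
    show "open S" by (rule Suc.prems)
    show "Ck_on k S (\<lambda>x. frechet_derivative f (at x) v)"
      using Suc.prems(3) by simp
    show "frechet_derivative f (at x) v = frechet_derivative g (at x) v" if "x \<in> S" for x
      using frechet_derivative_at[OF der[OF that]] by simp
  qed
  then show ?case
    using der by (auto simp: differentiable_def)
qed

text \<open>The recursive step of \<^const>\<open>Ck_on\<close> refers to the chosen
\<^const>\<open>frechet_derivative\<close>. This form accepts any derivative that has been computed, so that
each closure property below is an induction on \<open>k\<close> whose step is the usual derivative rule.\<close>

lemma Ck_on_SucI:
  assumes "open S" and der: "\<And>x. x \<in> S \<Longrightarrow> (f has_derivative f' x) (at x)"
    and "\<And>v. Ck_on k S (\<lambda>x. f' x v)"
  shows "Ck_on (Suc k) S f"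
proof -
  have "Ck_on k S (\<lambda>x. frechet_derivative f (at x) v)" for v
    by (rule Ck_on_cong[OF \<open>open S\<close> _ assms(3)[of v]])
       (simp add: frechet_derivative_at[OF der, symmetric])
  then show ?thesis
    using der by (auto simp: differentiable_def)
qed

lemma Ck_on_has_derivative:
  assumes "Ck_on (Suc k) S f" "x \<in> S"
  shows "(f has_derivative frechet_derivative f (at x)) (at x)"
  using assms by (simp add: frechet_derivative_works)

text \<open>The product and chain rules differentiate one factor and keep the other, so the
induction hypothesis for order \<open>k\<close> has to be applied to the undifferentiated factor, which is only
known to be of order \<open>Suc k\<close>.\<close>

lemma Ck_on_pred: "Ck_on (Suc k) S f \<Longrightarrow> Ck_on k S f"
proof (induction k arbitrary: f)
  case 0
  then show ?case
    by (auto intro!: continuous_at_imp_continuous_on differentiable_imp_continuous_within)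
next
  case (Suc k)
  then show ?case by (simp only: Ck_on.simps(2)) blast
qed

lemma Ck_on_const: "open S \<Longrightarrow> Ck_on k S (\<lambda>x. c)"
proof (induction k arbitrary: c)
  case (Suc k)
  then show ?case by (auto intro!: Ck_on_SucI derivative_eq_intros)
qed simp

lemma Ck_on_add:
  assumes "open S" "Ck_on k S f" "Ck_on k S g"
  shows "Ck_on k S (\<lambda>x. f x + g x)"
  using assms
proof (induction k arbitrary: f g)
  case 0
  then show ?case by (auto intro: continuous_intros)
next
  case (Suc k)
  show ?case
    by (rule Ck_on_SucI[OF \<open>open S\<close> has_derivative_add[OF Ck_on_has_derivative Ck_on_has_derivative]])
       (use Suc in auto)
qed

lemma Ck_on_bounded_linear:
  assumes "bounded_linear L" "open S" "Ck_on k S f"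
  shows "Ck_on k S (\<lambda>x. L (f x))"
  using assms(2,3)
proof (induction k arbitrary: f)
  case 0
  then show ?case using bounded_linear.continuous_on[OF assms(1)] by auto
next
  case (Suc k)
  show ?case
    by (rule Ck_on_SucI[OF \<open>open S\<close> bounded_linear.has_derivative[OF assms(1) Ck_on_has_derivative]])
       (use Suc in auto)
qed

lemma Ck_on_bounded_bilinear:
  assumes "bounded_bilinear B" "open S" "Ck_on k S f" "Ck_on k S g"
  shows "Ck_on k S (\<lambda>x. B (f x) (g x))"
  using assms(2-4)
proof (induction k arbitrary: f g)
  case 0
  then show ?case using bounded_bilinear.continuous_on[OF assms(1)] by auto
next
  case (Suc k)
  have "Ck_on k S (\<lambda>x. B (f x) (frechet_derivative g (at x) v) + B (frechet_derivative f (at x) v) (g x))" for v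
    using Suc Ck_on_pred[OF Suc.prems(2)] Ck_on_pred[OF Suc.prems(3)] by (intro Ck_on_add Suc.IH) auto
  note bilinear = this
  show ?case
    by (rule Ck_on_SucI[OF \<open>open S\<close> bounded_bilinear.FDERIV[OF assms(1) Ck_on_has_derivative Ck_on_has_derivative]])
       (use Suc bilinear in auto)
qed

lemma Ck_on_Pair:
  assumes "open S" "Ck_on k S f" "Ck_on k S g"
  shows "Ck_on k S (\<lambda>x. (f x, g x))"
  using assms
proof (induction k arbitrary: f g)
  case 0
  then show ?case by (auto intro: continuous_intros)
next
  case (Suc k)
  show ?case
    by (rule Ck_on_SucI[OF \<open>open S\<close> has_derivative_Pair[OF Ck_on_has_derivative Ck_on_has_derivative]])
       (use Suc in auto)
qed

text \<open>The derivative of \<open>h \<circ> f\<close> in direction \<open>v\<close> evaluates the derivative of \<open>h\<close> in a direction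
that varies with the point, whereas \<^const>\<open>Ck_on\<close> speaks about fixed directions only. Expanding
that direction in the standard basis leaves a sum of products of the components of the derivative
of \<open>f\<close> and of compositions of \<open>f\<close> with directional derivatives of \<open>h\<close>; to the latter the induction
hypothesis applies.\<close>

lemma Ck_on_compose:
  fixes f :: "'a::euclidean_space \<Rightarrow> 'b::euclidean_space"
  assumes "open S" "Ck_on k S f" "Ck_on k U h" "f ` S \<subseteq> U"
  shows "Ck_on k S (\<lambda>x. h (f x))"
  using assms
proof (induction k arbitrary: h)
  case 0
  then show ?case by (auto intro: continuous_on_compose2)
next
  case (Suc k)
  let ?h' = "\<lambda>y. frechet_derivative h (at y)" and ?f' = "\<lambda>x. frechet_derivative f (at x)"
  have f': "(f has_derivative ?f' x) (at x)" if "x \<in> S" for x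
    using Ck_on_has_derivative[OF Suc.prems(2) that] .
  have h': "(h has_derivative ?h' (f x)) (at (f x))" if "x \<in> S" for x
    using Ck_on_has_derivative[OF Suc.prems(3)] Suc.prems(4) that by blast
  have "Ck_on k S (\<lambda>x. \<Sum>b\<in>B. (?f' x v \<bullet> b) *\<^sub>R ?h' (f x) b)" if "finite B" for B :: "'b set" and v
    using that
  proof (induction B rule: finite_induct)
    case empty
    then show ?case using Ck_on_const[OF \<open>open S\<close>] by simp
  next
    case (insert b B)
    have "Ck_on k S (\<lambda>x. ?f' x v \<bullet> b)"
      using Suc.prems by (intro Ck_on_bounded_linear[OF bounded_linear_inner_left]) auto
    moreover have "Ck_on k S (\<lambda>x. ?h' (f x) b)"
      using Suc.prems Ck_on_pred[OF Suc.prems(2)] by (intro Suc.IH) auto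
    ultimately show ?case
      using insert \<open>open S\<close>
      by (simp add: Ck_on_add Ck_on_bounded_bilinear[OF bounded_bilinear_scaleR])
  qed
  from this[OF finite_Basis]
  have "Ck_on k S (\<lambda>x. \<Sum>b\<in>Basis. (?f' x v \<bullet> b) *\<^sub>R ?h' (f x) b)" for v .
  then have chain: "Ck_on k S (\<lambda>x. ?h' (f x) (?f' x v))" for v
  proof (rule Ck_on_cong[OF \<open>open S\<close>, rotated])
    fix x assume "x \<in> S"
    then have "linear (?h' (f x))" using h' has_derivative_linear by blast
    then have "?h' (f x) (\<Sum>b\<in>Basis. (?f' x v \<bullet> b) *\<^sub>R b) = (\<Sum>b\<in>Basis. (?f' x v \<bullet> b) *\<^sub>R ?h' (f x) b)"
      by (simp add: linear_sum linear_scale)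
    then show "(\<Sum>b\<in>Basis. (?f' x v \<bullet> b) *\<^sub>R ?h' (f x) b) = ?h' (f x) (?f' x v)"
      by (simp add: euclidean_representation)
  qed
  show ?case
    by (rule Ck_on_SucI[OF \<open>open S\<close> has_derivative_compose[OF f' h'] chain])
qed

lemma smooth_on_const: "open S \<Longrightarrow> smooth_on S (\<lambda>x. c)"
  by (simp add: smooth_on_def Ck_on_const)

lemma smooth_on_add: "open S \<Longrightarrow> smooth_on S f \<Longrightarrow> smooth_on S g \<Longrightarrow> smooth_on S (\<lambda>x. f x + g x)"
  by (simp add: smooth_on_def Ck_on_add)

lemma smooth_on_bounded_linear:
  "bounded_linear L \<Longrightarrow> open S \<Longrightarrow> smooth_on S f \<Longrightarrow> smooth_on S (\<lambda>x. L (f x))"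
  by (simp add: smooth_on_def Ck_on_bounded_linear)

lemma smooth_on_bounded_bilinear:
  "bounded_bilinear B \<Longrightarrow> open S \<Longrightarrow> smooth_on S f \<Longrightarrow> smooth_on S g \<Longrightarrow> smooth_on S (\<lambda>x. B (f x) (g x))"
  by (simp add: smooth_on_def Ck_on_bounded_bilinear)

lemmas smooth_on_scaleR = smooth_on_bounded_bilinear[OF bounded_bilinear_scaleR]
lemmas smooth_on_mult = smooth_on_bounded_bilinear[OF bounded_bilinear_mult]

lemma smooth_on_Pair:
  "open S \<Longrightarrow> smooth_on S f \<Longrightarrow> smooth_on S g \<Longrightarrow> smooth_on S (\<lambda>x. (f x, g x))"
  by (simp add: smooth_on_def Ck_on_Pair)

lemma smooth_on_compose:
  fixes f :: "'a::euclidean_space \<Rightarrow> 'b::euclidean_space"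
  shows "smooth_on U h \<Longrightarrow> open S \<Longrightarrow> smooth_on S f \<Longrightarrow> f ` S \<subseteq> U \<Longrightarrow> smooth_on S (\<lambda>x. h (f x))"
  unfolding smooth_on_def using Ck_on_compose by blast

lemma Ck_on_id: "open S \<Longrightarrow> Ck_on k S (\<lambda>x. x)"
proof (cases k)
  case (Suc l)
  assume "open S"
  then show ?thesis
    unfolding Suc by (intro Ck_on_SucI[of S "\<lambda>x. x" "\<lambda>x v. v"] Ck_on_const has_derivative_ident) auto
qed simp

lemma smooth_on_id: "open S \<Longrightarrow> smooth_on S (\<lambda>x. x)"
  by (simp add: smooth_on_def Ck_on_id)

lemma smooth_on_fst: "open S \<Longrightarrow> smooth_on S f \<Longrightarrow> smooth_on S (\<lambda>x. fst (f x))"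
  and smooth_on_snd: "open S \<Longrightarrow> smooth_on S f \<Longrightarrow> smooth_on S (\<lambda>x. snd (f x))"
  by (simp_all add: smooth_on_bounded_linear bounded_linear_fst bounded_linear_snd)

lemma smooth_on_minus: "open S \<Longrightarrow> smooth_on S f \<Longrightarrow> smooth_on S (\<lambda>x. - f x)"
  by (rule smooth_on_bounded_linear[OF bounded_linear_minus[OF bounded_linear_ident]])

lemma smooth_on_diff: "open S \<Longrightarrow> smooth_on S f \<Longrightarrow> smooth_on S g \<Longrightarrow> smooth_on S (\<lambda>x. f x - g x)"
  using smooth_on_add[of S f "\<lambda>x. - g x"] smooth_on_minus[of S g] by simp

lemma smooth_on_differentiable: "smooth_on S f \<Longrightarrow> x \<in> S \<Longrightarrow> f differentiable (at x)"
  unfolding smooth_on_def using Ck_on.simps(2) by blast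

lemma smooth_on_continuous_on: "smooth_on S f \<Longrightarrow> continuous_on S f"
  unfolding smooth_on_def using Ck_on.simps(1) by blast

section \<open>Smoothness of elementary functions\<close>

lemma Ck_on_Suc_real:
  fixes f :: "real \<Rightarrow> real"
  assumes "open S" "\<And>x. x \<in> S \<Longrightarrow> (f has_real_derivative f' x) (at x)" "Ck_on k S f'"
  shows "Ck_on (Suc k) S f"
proof (rule Ck_on_SucI[OF \<open>open S\<close>])
  show "(f has_derivative (\<lambda>v. f' x * v)) (at x)" if "x \<in> S" for x
    using assms(2)[OF that] by (simp add: has_field_derivative_def)
  show "Ck_on k S (\<lambda>x. f' x * v)" for v
    using assms by (intro Ck_on_bounded_linear[OF bounded_linear_mult_left])
qed

lemma smooth_on_if_derivative_smooth_on:
  fixes f :: "real \<Rightarrow> real"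
  assumes "open S" "\<And>x. x \<in> S \<Longrightarrow> (f has_real_derivative f' x) (at x)" "smooth_on S f'"
  shows "smooth_on S f"
  using Ck_on_pred[OF Ck_on_Suc_real[OF assms(1,2)]] assms(3) by (auto simp: smooth_on_def)

text \<open>The pairs \<open>sin\<close>, \<open>cos\<close> and \<open>sinh\<close>, \<open>cosh\<close> are closed under differentiation up to sign,
the derivative of \<open>inverse\<close> is expressed by \<open>inverse\<close>, and that of \<open>sqrt\<close> by \<open>inverse\<close> and \<open>sqrt\<close>,
so in each case smoothness follows by induction on the order. The inverse functions \<open>arcsin\<close>, \<open>arsinh\<close> and
\<open>arcosh\<close> have derivatives built from these.\<close>

lemma smooth_on_sin_cos:
  "smooth_on UNIV (sin :: real \<Rightarrow> real)" "smooth_on UNIV (cos :: real \<Rightarrow> real)"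
proof -
  have "Ck_on k UNIV (sin :: real \<Rightarrow> real) \<and> Ck_on k UNIV (cos :: real \<Rightarrow> real)" for k
  proof (induction k)
    case 0
    then show ?case by (auto intro: continuous_intros)
  next
    case (Suc k)
    have "Ck_on k UNIV (\<lambda>x::real. - sin x)"
      using Suc by (intro Ck_on_bounded_linear[OF bounded_linear_minus[OF bounded_linear_ident]]) auto
    then show ?case
      using Suc Ck_on_Suc_real[OF open_UNIV DERIV_sin] Ck_on_Suc_real[OF open_UNIV DERIV_cos] by blast
  qed
  then show "smooth_on UNIV (sin :: real \<Rightarrow> real)" "smooth_on UNIV (cos :: real \<Rightarrow> real)"
    by (auto simp: smooth_on_def)
qed

lemma smooth_on_sinh_cosh:
  "smooth_on UNIV (sinh :: real \<Rightarrow> real)" "smooth_on UNIV (cosh :: real \<Rightarrow> real)"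
proof -
  have "Ck_on k UNIV (sinh :: real \<Rightarrow> real) \<and> Ck_on k UNIV (cosh :: real \<Rightarrow> real)" for k
  proof (induction k)
    case 0
    then show ?case by (auto intro: continuous_intros)
  next
    case (Suc k)
    have "(sinh has_real_derivative cosh x) (at x)" "(cosh has_real_derivative sinh x) (at x)" for x :: real
      by (auto intro!: derivative_eq_intros)
    then show ?case
      using Suc Ck_on_Suc_real[OF open_UNIV] by blast
  qed
  then show "smooth_on UNIV (sinh :: real \<Rightarrow> real)" "smooth_on UNIV (cosh :: real \<Rightarrow> real)"
    by (auto simp: smooth_on_def)
qed

lemma smooth_on_inverse: "smooth_on (- {0}) (inverse :: real \<Rightarrow> real)"
proof -
  have "Ck_on k (- {0}) (inverse :: real \<Rightarrow> real)" for k
  proof (induction k)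
    case 0
    then show ?case by (auto intro!: continuous_intros)
  next
    case (Suc k)
    have "Ck_on k (- {0}) (\<lambda>x::real. - (inverse x * inverse x))"
      using Suc by (intro Ck_on_bounded_linear[OF bounded_linear_minus[OF bounded_linear_ident]]
          Ck_on_bounded_bilinear[OF bounded_bilinear_mult]) auto
    then show ?case
      by (rule Ck_on_Suc_real[rotated 2])
         (auto intro!: derivative_eq_intros)
  qed
  then show ?thesis by (simp add: smooth_on_def)
qed

lemma smooth_on_divide:
  fixes f g :: "'a::euclidean_space \<Rightarrow> real"
  assumes "open S" "smooth_on S f" "smooth_on S g" "\<And>x. x \<in> S \<Longrightarrow> g x \<noteq> 0"
  shows "smooth_on S (\<lambda>x. f x / g x)"
proof -
  have "smooth_on S (\<lambda>x. inverse (g x))"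
    using assms by (intro smooth_on_compose[OF smooth_on_inverse]) auto
  then show ?thesis
    using assms smooth_on_mult[of S f] by (simp add: divide_inverse)
qed

lemma smooth_on_sqrt: "smooth_on {0<..} sqrt"
proof -
  have "Ck_on k {0<..} sqrt" for k
  proof (induction k)
    case 0
    then show ?case by (auto intro!: continuous_intros)
  next
    case (Suc k)
    have inverse: "Ck_on k (- {0}) (inverse :: real \<Rightarrow> real)"
      using smooth_on_inverse by (simp add: smooth_on_def)
    have "Ck_on k {0<..} (\<lambda>x. inverse (sqrt x))"
      by (rule Ck_on_compose[OF _ Suc inverse]) auto
    then have "Ck_on k {0<..} (\<lambda>x. inverse (sqrt x) / 2)"
      by (rule Ck_on_bounded_linear[OF bounded_linear_divide open_greaterThan])
    then show ?case
      by (rule Ck_on_Suc_real[rotated 2]) (simp_all add: DERIV_real_sqrt)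
  qed
  then show ?thesis by (simp add: smooth_on_def)
qed

lemma smooth_on_inverse_sqrt:
  fixes f :: "'a::euclidean_space \<Rightarrow> real"
  assumes "open S" "smooth_on S f" "\<And>x. x \<in> S \<Longrightarrow> f x > 0"
  shows "smooth_on S (\<lambda>x. 1 / sqrt (f x))"
proof (rule smooth_on_divide[OF \<open>open S\<close> smooth_on_const[OF \<open>open S\<close>]])
  show "smooth_on S (\<lambda>x. sqrt (f x))"
    using assms by (intro smooth_on_compose[OF smooth_on_sqrt]) auto
  show "sqrt (f x) \<noteq> 0" if "x \<in> S" for x
    using assms(3)[OF that] by simp
qed

lemma smooth_on_power2:
  fixes f :: "'a::euclidean_space \<Rightarrow> real"
  shows "open S \<Longrightarrow> smooth_on S f \<Longrightarrow> smooth_on S (\<lambda>x. (f x)\<^sup>2)"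
  unfolding power2_eq_square by (rule smooth_on_mult)

lemma smooth_on_arcsin: "smooth_on {-1<..<1} arcsin"
proof (rule smooth_on_if_derivative_smooth_on)
  show "(arcsin has_real_derivative 1 / sqrt (1 - x\<^sup>2)) (at x)" if "x \<in> {-1<..<1}" for x
    using that DERIV_arcsin[of x] by (simp add: divide_inverse)
  show "smooth_on {-1<..<1} (\<lambda>x::real. 1 / sqrt (1 - x\<^sup>2))"
    by (intro smooth_on_inverse_sqrt smooth_on_diff smooth_on_const smooth_on_power2 smooth_on_id
        open_greaterThanLessThan) (simp add: abs_square_less_1 abs_less_iff)
qed simp

lemma smooth_on_arsinh: "smooth_on UNIV (arsinh :: real \<Rightarrow> real)"
proof (rule smooth_on_if_derivative_smooth_on)
  show "(arsinh has_real_derivative 1 / sqrt (x\<^sup>2 + 1)) (at x)" for x :: real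
    by (rule arsinh_real_has_field_derivative)
  show "smooth_on UNIV (\<lambda>x::real. 1 / sqrt (x\<^sup>2 + 1))"
    by (intro smooth_on_inverse_sqrt smooth_on_add smooth_on_const smooth_on_power2 smooth_on_id
        open_UNIV) (simp add: add_nonneg_pos)
qed simp

lemma smooth_on_arcosh: "smooth_on {1<..} (arcosh :: real \<Rightarrow> real)"
proof (rule smooth_on_if_derivative_smooth_on)
  show "(arcosh has_real_derivative 1 / sqrt (x\<^sup>2 - 1)) (at x)" if "x \<in> {1<..}" for x :: real
    using that by (intro arcosh_real_has_field_derivative) simp
  show "smooth_on {1<..} (\<lambda>x::real. 1 / sqrt (x\<^sup>2 - 1))"
    by (intro smooth_on_inverse_sqrt smooth_on_diff smooth_on_const smooth_on_power2 smooth_on_id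
        open_greaterThan) simp
qed simp

section \<open>The Lorentz product and envelopes\<close>

lemma bounded_bilinear_lprod: "bounded_bilinear lprod"
  unfolding bilinear_conv_bounded_bilinear[symmetric] bilinear_def
  by (auto intro!: linearI simp: lprod_def algebra_simps)

interpretation lprod: bounded_bilinear lprod
  by (rule bounded_bilinear_lprod)

lemma lprod_commute: "lprod u v = lprod v u"
  by (simp add: lprod_def mult.commute)

lemmas lprod_simps = lprod.add_left lprod.add_right lprod.scaleR_left lprod.scaleR_right

lemma lprod_self_constant_imp_derivative_orthogonal:
  assumes "(V has_vector_derivative V') (at x)" "open N" "x \<in> N"
    and const: "\<And>y. y \<in> N \<Longrightarrow> lprod (V y) (V y) = c"
  shows "lprod (V x) V' = 0"
proof -
  have "((\<lambda>y. lprod (V y) (V y)) has_vector_derivative lprod (V x) V' + lprod V' (V x)) (at x)"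
    using assms(1) by (intro lprod.has_vector_derivative)
  moreover have "((\<lambda>y. lprod (V y) (V y)) has_vector_derivative 0) (at x)"
    by (rule has_vector_derivative_transform_within_open[OF has_vector_derivative_const assms(2,3)])
       (simp add: const)
  ultimately have "lprod (V x) V' + lprod V' (V x) = 0"
    by (rule vector_derivative_unique_at)
  then show ?thesis by (simp add: lprod_commute)
qed

text \<open>Along a coordinate line \<open>c\<close>, the vector from the moving center \<open>\<delta>\<close> to \<open>T \<circ> c\<close> has constant
length, hence is orthogonal to the difference of the two velocities. The lemma is used with
\<open>\<delta> = \<gamma>\<close> for the \<open>s\<close>-line and with a constant \<open>\<delta>\<close> for the lines of \<open>t\<close> and \<open>w\<close>.\<close>

lemma lprod_slice_velocity:
  fixes T :: "real \<times> real \<times> real \<Rightarrow> real ^ 4"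
  assumes "open U" "c x \<in> U" "T differentiable (at (c x))"
    and "c differentiable (at x)" "continuous_on UNIV c"
    and \<delta>: "(\<delta> has_vector_derivative d) (at x)"
    and const: "\<And>y. c y \<in> U \<Longrightarrow> lprod (T (c y) - \<delta> y) (T (c y) - \<delta> y) = \<kappa>"
  shows "lprod (T (c x) - \<delta> x) (vector_derivative (\<lambda>y. T (c y)) (at x)) = lprod (T (c x) - \<delta> x) d"
proof -
  have "(\<lambda>y. T (c y)) differentiable (at x)"
    using differentiable_chain_at[OF assms(4,3)] by (simp add: o_def)
  then have "((\<lambda>y. T (c y)) has_vector_derivative vector_derivative (\<lambda>y. T (c y)) (at x)) (at x)"
    by (simp add: vector_derivative_works)
  from has_vector_derivative_diff[OF this \<delta>]
  have "lprod (T (c x) - \<delta> x) (vector_derivative (\<lambda>y. T (c y)) (at x) - d) = 0"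
    by (rule lprod_self_constant_imp_derivative_orthogonal[where N = "c -` U" and c = \<kappa>])
       (use assms const in \<open>auto intro: open_vimage\<close>)
  then show ?thesis by (simp add: lprod.diff_right)
qed

text \<open>For a map whose points lie on the spheres around \<open>\<gamma>\<close>, orthogonality to the \<open>t\<close>- and
\<open>w\<close>-tangents is automatic, and orthogonality to the \<open>s\<close>-tangent amounts to orthogonality to
\<open>\<gamma>' = F1\<close>. Being an envelope thus means lying, for each \<open>s\<close>, in the section of the sphere around
\<open>\<gamma> s\<close> by the normal hyperplane of the curve, and no derivative of \<open>T\<close> remains in the condition.\<close>

lemma tubular_hypersurface_iff_normal_plane:
  assumes Q: "\<And>p u. u \<in> Q p r \<longleftrightarrow> lprod (u - p) (u - p) = \<kappa>"
    and \<gamma>: "\<And>s. s \<in> I \<Longrightarrow> (\<gamma> has_vector_derivative F1 s) (at s)"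
    and U: "open U" "U \<subseteq> I \<times> UNIV" and T: "smooth_on U T"
  shows "tubular_hypersurface Q I \<gamma> r U T \<longleftrightarrow>
    (\<forall>(s, q)\<in>U. lprod (T (s, q) - \<gamma> s) (T (s, q) - \<gamma> s) = \<kappa> \<and> lprod (T (s, q) - \<gamma> s) (F1 s) = 0)"
proof -
  let ?V = "\<lambda>s q. T (s, q) - \<gamma> s"
  have "(lprod (?V s (t, w)) (vector_derivative (\<lambda>x. T (x, t, w)) (at s)) = 0 \<and>
        lprod (?V s (t, w)) (vector_derivative (\<lambda>x. T (s, x, w)) (at t)) = 0 \<and>
        lprod (?V s (t, w)) (vector_derivative (\<lambda>x. T (s, t, x)) (at w)) = 0)
      \<longleftrightarrow> lprod (?V s (t, w)) (F1 s) = 0"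
    if in_U: "(s, t, w) \<in> U" and const: "\<forall>s t w. (s, t, w) \<in> U \<longrightarrow> lprod (?V s (t, w)) (?V s (t, w)) = \<kappa>" for s t w
  proof -
    have "s \<in> I" using in_U U by auto
    have "(\<lambda>x. (x, t, w)) differentiable (at s)" "(\<lambda>x. (s, x, w)) differentiable (at t)"
      "(\<lambda>x. (s, t, x)) differentiable (at w)"
      by (intro differentiable_Pair differentiable_ident differentiable_const)+
    note differentiable = this smooth_on_differentiable[OF T in_U]
    have "lprod (?V s (t, w)) (vector_derivative (\<lambda>x. T (x, t, w)) (at s)) = lprod (?V s (t, w)) (F1 s)"
      by (rule lprod_slice_velocity[OF U(1), of "\<lambda>x. (x, t, w)" s T \<gamma> "F1 s" \<kappa>])
         (use in_U const \<gamma>[OF \<open>s \<in> I\<close>] differentiable in \<open>auto intro!: continuous_intros\<close>)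
    moreover have "lprod (?V s (t, w)) (vector_derivative (\<lambda>x. T (s, x, w)) (at t)) = lprod (?V s (t, w)) 0"
      by (rule lprod_slice_velocity[OF U(1), of "\<lambda>x. (s, x, w)" t T "\<lambda>_. \<gamma> s" 0 \<kappa>])
         (use in_U const differentiable in \<open>auto intro!: continuous_intros\<close>)
    moreover have "lprod (?V s (t, w)) (vector_derivative (\<lambda>x. T (s, t, x)) (at w)) = lprod (?V s (t, w)) 0"
      by (rule lprod_slice_velocity[OF U(1), of "\<lambda>x. (s, t, x)" w T "\<lambda>_. \<gamma> s" 0 \<kappa>])
         (use in_U const differentiable in \<open>auto intro!: continuous_intros\<close>)
    ultimately show ?thesis by (simp add: lprod.zero_right)
  qed
  then show ?thesis
    unfolding tubular_hypersurface_def Q Ball_def split_paired_All prod.case using U T by blast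
qed

section \<open>The common shape of the four parametrizations\<close>

text \<open>The four families differ only in the pair \<open>A\<close>, \<open>B\<close> of functions and the sign \<open>\<epsilon>\<close>. They satisfy
\<open>A\<^sup>2 + \<epsilon> B\<^sup>2 = \<kappa>\<close>, where \<open>\<kappa>\<close> is \<open>1\<close> for pseudo hyperspheres and \<open>- 1\<close> for pseudo hyperbolic
hyperspheres.\<close>

definition frame_tube ::
  "(real \<Rightarrow> real ^ 4) \<Rightarrow> (real \<Rightarrow> real ^ 4) \<Rightarrow> (real \<Rightarrow> real ^ 4) \<Rightarrow> (real \<Rightarrow> real ^ 4) \<Rightarrow> real \<Rightarrow>
   (real \<Rightarrow> real) \<Rightarrow> (real \<Rightarrow> real) \<Rightarrow> real \<Rightarrow>
   real \<Rightarrow> (real \<times> real \<Rightarrow> real) \<Rightarrow> (real \<times> real \<Rightarrow> real) \<Rightarrow> real \<times> real \<times> real \<Rightarrow> real ^ 4" where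
  "frame_tube \<gamma> F2 F3 F4 r A B \<epsilon> \<sigma> f g = (\<lambda>(s, q).
     \<gamma> s + (\<sigma> * r) *\<^sub>R (A (f q) *\<^sub>R F2 s + (g q * B (f q)) *\<^sub>R F3 s + (\<epsilon> * B (f q) / (2 * g q)) *\<^sub>R F4 s))"

lemma T1_eq_frame_tube: "T1 \<gamma> F2 F3 F4 r = frame_tube \<gamma> F2 F3 F4 r sin cos 1"
  and T2_eq_frame_tube: "T2 \<gamma> F2 F3 F4 r = frame_tube \<gamma> F2 F3 F4 r cos sin 1"
  and T3_eq_frame_tube: "T3 \<gamma> F2 F3 F4 r = frame_tube \<gamma> F2 F3 F4 r cosh sinh (- 1)"
  and T4_eq_frame_tube: "T4 \<gamma> F2 F3 F4 r = frame_tube \<gamma> F2 F3 F4 r sinh cosh (- 1)"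
  by (auto simp: fun_eq_iff T1_def T2_def T3_def T4_def frame_tube_def)

section \<open>The frame of a partially null curve\<close>

locale partially_null_frame =
  fixes I :: "real set" and \<gamma> F1 F2 F3 F4 :: "real \<Rightarrow> real ^ 4"
    and k1 k2 k3 :: "real \<Rightarrow> real"
  assumes curve: "partially_null_curve I \<gamma> F1 F2 F3 F4 k1 k2 k3"
begin

lemma open_I: "open I"
  and velocity: "s \<in> I \<Longrightarrow> (\<gamma> has_vector_derivative F1 s) (at s)"
  and smooth_frame: "smooth_on I \<gamma>" "smooth_on I F2" "smooth_on I F3" "smooth_on I F4"
  using curve by (auto simp: partially_null_curve_def)

lemma frame_products:
  assumes "s \<in> I"
  shows "lprod (F1 s) (F1 s) = 1" "lprod (F2 s) (F2 s) = 1" "lprod (F3 s) (F3 s) = 0" "lprod (F4 s) (F4 s) = 0"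
    "lprod (F1 s) (F2 s) = 0" "lprod (F1 s) (F3 s) = 0" "lprod (F1 s) (F4 s) = 0"
    "lprod (F2 s) (F3 s) = 0" "lprod (F2 s) (F4 s) = 0" "lprod (F3 s) (F4 s) = 1"
    "lprod (F2 s) (F1 s) = 0" "lprod (F3 s) (F1 s) = 0" "lprod (F4 s) (F1 s) = 0"
    "lprod (F3 s) (F2 s) = 0" "lprod (F4 s) (F2 s) = 0" "lprod (F4 s) (F3 s) = 1"
  using curve assms by (auto simp: partially_null_curve_def lprod_commute)

text \<open>The Gram matrix of the frame is invertible, so the four vectors form a basis. Since \<open>F3\<close> and
\<open>F4\<close> are null and dual to each other, the coefficient of each is the product with the other.\<close>

lemma frame_expansion:
  assumes "s \<in> I"
  shows "v = lprod v (F1 s) *\<^sub>R F1 s + lprod v (F2 s) *\<^sub>R F2 s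
           + lprod v (F4 s) *\<^sub>R F3 s + lprod v (F3 s) *\<^sub>R F4 s"
proof -
  \<comment> \<open>The products of \<open>?L x\<close> with the frame return the components of \<open>x\<close>. Hence \<open>?L\<close> is injective,
    and by equality of dimensions also surjective.\<close>
  let ?L = "\<lambda>x :: real ^ 4. (x $ 1) *\<^sub>R F1 s + (x $ 2) *\<^sub>R F2 s + (x $ 3) *\<^sub>R F3 s + (x $ 4) *\<^sub>R F4 s"
  have coord: "lprod (?L x) (F1 s) = x $ 1" "lprod (?L x) (F2 s) = x $ 2"
    "lprod (?L x) (F4 s) = x $ 3" "lprod (?L x) (F3 s) = x $ 4" for x
    by (simp_all add: lprod_simps frame_products[OF assms])
  have "linear ?L"
    by (auto intro!: linearI simp: algebra_simps scaleR_add_right)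
  moreover have "inj ?L"
  proof (rule injI)
    fix x y assume "?L x = ?L y"
    then have "x $ 1 = y $ 1" "x $ 2 = y $ 2" "x $ 3 = y $ 3" "x $ 4 = y $ 4"
      using coord[of x] coord[of y] by simp_all
    then show "x = y" by (simp add: vec_eq_iff forall_4)
  qed
  ultimately have "surj ?L"
    by (rule linear_injective_imp_surjective) simp
  then obtain x where "v = ?L x"
    by (rule surjE)
  then show ?thesis using coord[of x] by simp
qed

lemma lprod_self_frame_combination:
  assumes "s \<in> I"
  shows "lprod (a *\<^sub>R F2 s + b *\<^sub>R F3 s + c *\<^sub>R F4 s) (a *\<^sub>R F2 s + b *\<^sub>R F3 s + c *\<^sub>R F4 s) = a\<^sup>2 + 2 * b * c"
  by (simp add: lprod_simps frame_products[OF assms] power2_eq_square algebra_simps)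

text \<open>The two null coefficients are \<open>g B\<close> and \<open>\<epsilon> B / (2 g)\<close>, so that \<open>g\<close> cancels from twice their
product, which is \<open>\<epsilon> B\<^sup>2\<close>. The squared length is therefore \<open>(A\<^sup>2 + \<epsilon> B\<^sup>2) r\<^sup>2\<close> for every choice of
\<open>f\<close> and \<open>g\<close>.\<close>

lemma frame_tube_tubular:
  assumes Q: "\<And>p u. u \<in> Q p r \<longleftrightarrow> lprod (u - p) (u - p) = \<kappa> * r\<^sup>2"
    and AB: "smooth_on UNIV A" "smooth_on UNIV B" "\<And>x. (A x)\<^sup>2 + \<epsilon> * (B x)\<^sup>2 = \<kappa>"
    and D: "coefficient_functions D f g" and \<sigma>: "\<sigma> \<in> {1, - 1}"
  shows "tubular_hypersurface Q I \<gamma> r (I \<times> D) (frame_tube \<gamma> F2 F3 F4 r A B \<epsilon> \<sigma> f g)"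
proof -
  let ?T = "frame_tube \<gamma> F2 F3 F4 r A B \<epsilon> \<sigma> f g" and ?U = "I \<times> D"
  have open_U: "open ?U" and g0: "\<And>q. q \<in> D \<Longrightarrow> g q \<noteq> 0"
    and f: "smooth_on D f" and g: "smooth_on D g"
    using D open_I by (auto simp: coefficient_functions_def intro: open_Times)
  have curve_part: "smooth_on ?U (\<lambda>p. F (fst p))" if "smooth_on I F" for F :: "real \<Rightarrow> real ^ 4"
    by (rule smooth_on_compose[OF that open_U smooth_on_fst[OF open_U smooth_on_id[OF open_U]]]) auto
  have coeff_part: "smooth_on ?U (\<lambda>p. h (snd p))" if "smooth_on D h" for h :: "real \<times> real \<Rightarrow> real"
    by (rule smooth_on_compose[OF that open_U smooth_on_snd[OF open_U smooth_on_id[OF open_U]]]) auto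
  have Af: "smooth_on ?U (\<lambda>p. A (f (snd p)))" and Bf: "smooth_on ?U (\<lambda>p. B (f (snd p)))"
    by (rule smooth_on_compose[OF AB(1) open_U coeff_part[OF f]] smooth_on_compose[OF AB(2) open_U coeff_part[OF f]]; simp)+
  have "smooth_on ?U (\<lambda>p. \<gamma> (fst p) + (\<sigma> * r) *\<^sub>R (A (f (snd p)) *\<^sub>R F2 (fst p)
      + (g (snd p) * B (f (snd p))) *\<^sub>R F3 (fst p) + (\<epsilon> * B (f (snd p)) / (2 * g (snd p))) *\<^sub>R F4 (fst p)))"
    using g0 by (intro smooth_on_add smooth_on_scaleR smooth_on_mult smooth_on_divide smooth_on_const open_U
        curve_part smooth_frame Af Bf coeff_part g) auto
  then have "smooth_on ?U ?T"
    by (simp add: frame_tube_def case_prod_beta')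
  moreover have "lprod (?T (s, q) - \<gamma> s) (?T (s, q) - \<gamma> s) = \<kappa> * r\<^sup>2" "lprod (?T (s, q) - \<gamma> s) (F1 s) = 0"
    if s: "s \<in> I" and q: "q \<in> D" for s q
  proof -
    have "\<sigma> * \<sigma> = 1" using \<sigma> by auto
    moreover have "(A (f q))\<^sup>2 + 2 * (g q * B (f q)) * (\<epsilon> * B (f q) / (2 * g q)) = (A (f q))\<^sup>2 + \<epsilon> * (B (f q))\<^sup>2"
      using g0[OF q] by (simp add: field_simps power2_eq_square)
    ultimately show "lprod (?T (s, q) - \<gamma> s) (?T (s, q) - \<gamma> s) = \<kappa> * r\<^sup>2"
      unfolding frame_tube_def
      by (simp only: prod.case add_diff_cancel_left' lprod.scaleR_left lprod.scaleR_right
          lprod_self_frame_combination[OF s] AB(3)) (simp add: power2_eq_square algebra_simps)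
    show "lprod (?T (s, q) - \<gamma> s) (F1 s) = 0"
      by (simp add: frame_tube_def lprod_simps frame_products[OF s])
  qed
  ultimately show ?thesis
    by (subst tubular_hypersurface_iff_normal_plane[where Q = Q and r = r, OF Q velocity open_U]) auto
qed

section \<open>Reconstruction of a tubular hypersurface\<close>

definition normal_coordinate ::
  "(real \<times> real \<times> real \<Rightarrow> real ^ 4) \<Rightarrow> real \<Rightarrow> (real \<Rightarrow> real ^ 4) \<Rightarrow> real \<times> real \<times> real \<Rightarrow> real" where
  "normal_coordinate T r F p = lprod (T p - \<gamma> (fst p)) (F (fst p)) / r"

text \<open>From here on \<open>a\<close>, \<open>b\<close>, \<open>c\<close> are the coefficients of \<open>(T - \<gamma>) / r\<close> along \<open>F2\<close>, \<open>F3\<close>, \<open>F4\<close>. The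
duality of the null vectors explains why \<open>b\<close> is formed with \<open>F4\<close> and \<open>c\<close> with \<open>F3\<close>.\<close>

context
  fixes Q :: "real ^ 4 \<Rightarrow> real \<Rightarrow> (real ^ 4) set" and r \<kappa> :: real and U T and a b c
  assumes Q: "\<And>p u. u \<in> Q p r \<longleftrightarrow> lprod (u - p) (u - p) = \<kappa> * r\<^sup>2" and r: "r > 0"
    and tube: "tubular_hypersurface Q I \<gamma> r U T"
  defines "a \<equiv> normal_coordinate T r F2" and "b \<equiv> normal_coordinate T r F4" and "c \<equiv> normal_coordinate T r F3"
begin

lemma tubular_domain: "open U" "U \<subseteq> I \<times> UNIV" and smooth_tubular: "smooth_on U T"
  using tube by (auto simp: tubular_hypersurface_def)

lemma tubular_normal:
  assumes "p \<in> U"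
  shows "lprod (T p - \<gamma> (fst p)) (T p - \<gamma> (fst p)) = \<kappa> * r\<^sup>2" "lprod (T p - \<gamma> (fst p)) (F1 (fst p)) = 0"
  using tube assms tubular_hypersurface_iff_normal_plane[where Q = Q and r = r,
      OF Q velocity tubular_domain smooth_tubular] by auto

lemma smooth_normal_coordinate:
  assumes F: "smooth_on I F"
  shows "smooth_on U (normal_coordinate T r F)"
proof -
  have curve_part: "smooth_on U (\<lambda>p. G (fst p))" if "smooth_on I G" for G :: "real \<Rightarrow> real ^ 4"
    using tubular_domain by (intro smooth_on_compose[OF that] smooth_on_fst smooth_on_id) auto
  show ?thesis
    unfolding normal_coordinate_def using r
    by (intro smooth_on_divide smooth_on_bounded_bilinear[OF bounded_bilinear_lprod] smooth_on_diff
        smooth_on_const tubular_domain smooth_tubular curve_part F smooth_frame) auto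
qed

lemma tubular_frame_expansion:
  assumes "(s, q) \<in> U"
  shows "T (s, q) = \<gamma> s + r *\<^sub>R (a (s, q) *\<^sub>R F2 s + b (s, q) *\<^sub>R F3 s + c (s, q) *\<^sub>R F4 s)"
proof -
  have "s \<in> I" using assms tubular_domain by auto
  have "T (s, q) - \<gamma> s = r *\<^sub>R (a (s, q) *\<^sub>R F2 s + b (s, q) *\<^sub>R F3 s + c (s, q) *\<^sub>R F4 s)"
    using frame_expansion[OF \<open>s \<in> I\<close>, of "T (s, q) - \<gamma> s"] tubular_normal(2)[OF assms] r
    by (simp add: a_def b_def c_def normal_coordinate_def scaleR_add_right)
  then show ?thesis by (simp only: diff_eq_eq add.commute)
qed

lemma tubular_quadric:
  assumes "p \<in> U"
  shows "(a p)\<^sup>2 + 2 * b p * c p = \<kappa>"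
proof -
  obtain s q where p: "p = (s, q)" by (cases p)
  have "s \<in> I" using assms tubular_domain p by auto
  have "r * (r * ((a p)\<^sup>2 + 2 * b p * c p)) = lprod (T p - \<gamma> s) (T p - \<gamma> s)"
    unfolding p tubular_frame_expansion[OF assms[unfolded p]]
    by (simp only: add_diff_cancel_left' lprod.scaleR_left lprod.scaleR_right real_scaleR_def
        lprod_self_frame_combination[OF \<open>s \<in> I\<close>])
  also have "\<dots> = r * (r * \<kappa>)"
    using tubular_normal[OF assms] p by (simp add: power2_eq_square)
  finally show ?thesis using r by simp
qed

text \<open>The sign of \<open>b c\<close> decides on which side of \<open>1\<close> the square of \<open>a\<close> lies, because of
\<open>a\<^sup>2 + 2 b c = \<kappa>\<close>; for \<open>\<kappa> = 1\<close> this separates the trigonometric families from the hyperbolic one.\<close>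

lemma null_product_sign:
  "0 < lprod (T (s, q) - \<gamma> s) (F3 s) * lprod (T (s, q) - \<gamma> s) (F4 s) \<longleftrightarrow> 0 < b (s, q) * c (s, q)"
  "lprod (T (s, q) - \<gamma> s) (F3 s) * lprod (T (s, q) - \<gamma> s) (F4 s) < 0 \<longleftrightarrow> b (s, q) * c (s, q) < 0"
proof -
  have "lprod (T (s, q) - \<gamma> s) (F3 s) * lprod (T (s, q) - \<gamma> s) (F4 s) = r\<^sup>2 * (b (s, q) * c (s, q))"
    using r by (simp add: b_def c_def normal_coordinate_def power2_eq_square)
  moreover have "0 < r\<^sup>2" using r by simp
  ultimately show "0 < lprod (T (s, q) - \<gamma> s) (F3 s) * lprod (T (s, q) - \<gamma> s) (F4 s) \<longleftrightarrow> 0 < b (s, q) * c (s, q)"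
    "lprod (T (s, q) - \<gamma> s) (F3 s) * lprod (T (s, q) - \<gamma> s) (F4 s) < 0 \<longleftrightarrow> b (s, q) * c (s, q) < 0"
    by (simp_all only: zero_less_mult_iff[of "r\<^sup>2"] mult_less_0_iff[of "r\<^sup>2"]) auto
qed

text \<open>Equating coefficients, \<open>f\<close> has to solve \<open>A (f) = \<sigma> a\<close>, and then \<open>g = \<sigma> b / B (f)\<close> is
forced by the coefficient of \<open>F3\<close>; the coefficient of \<open>F4\<close> fits because of the quadric equation
\<open>a\<^sup>2 + 2 b c = \<kappa>\<close>. The first equation is solved by a smooth right inverse \<open>h\<close> of \<open>A\<close>. As \<open>f\<close> and \<open>g\<close>
may depend on two parameters only, while \<open>a\<close> and \<open>b\<close> depend on three, the signed coefficients
\<open>(\<sigma> a, \<sigma> b)\<close> themselves serve as the new parameters.\<close>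

lemma tubular_parametrized_by_frame_tube:
  assumes B: "smooth_on UNIV B" and AB: "\<And>x. (A x)\<^sup>2 + \<epsilon> * (B x)\<^sup>2 = \<kappa>"
    and J: "open J" and h: "smooth_on J h" "\<And>x. x \<in> J \<Longrightarrow> A (h x) = x" "\<And>x. x \<in> J \<Longrightarrow> B (h x) \<noteq> 0"
    and \<sigma>: "\<sigma> \<in> {1, - 1}" and a_J: "\<And>p. p \<in> U \<Longrightarrow> \<sigma> * a p \<in> J" and b0: "\<And>p. p \<in> U \<Longrightarrow> b p \<noteq> 0"
  shows "parametrized_by U T (frame_tube \<gamma> F2 F3 F4 r A B \<epsilon>)"
proof -
  define D where "D = J \<times> (- {0 :: real})"
  define f where "f = (\<lambda>q :: real \<times> real. h (fst q))"
  define g where "g = (\<lambda>q :: real \<times> real. snd q / B (h (fst q)))"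
  define \<phi> where "\<phi> = (\<lambda>p. (\<sigma> * a p, \<sigma> * b p))"
  have D: "open D" unfolding D_def using J by (intro open_Times) auto
  have f: "smooth_on D f"
    unfolding f_def using D by (intro smooth_on_compose[OF h(1)] smooth_on_fst smooth_on_id) (auto simp: D_def)
  have "smooth_on D (\<lambda>q. B (f q))"
    using D f by (intro smooth_on_compose[OF B]) auto
  then have g: "smooth_on D g"
    unfolding g_def using D h(3)
    by (intro smooth_on_divide smooth_on_snd smooth_on_id) (auto simp: D_def f_def)
  have coeff: "coefficient_functions D f g"
    using D f g h(3) by (auto simp: coefficient_functions_def D_def g_def)
  have "smooth_on U \<phi>"
    unfolding \<phi>_def a_def b_def
    by (intro smooth_on_Pair smooth_on_mult smooth_on_const smooth_normal_coordinate smooth_frame tubular_domain)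
  moreover have "\<phi> ` U \<subseteq> D"
    using a_J b0 \<sigma> by (auto simp: \<phi>_def D_def)
  moreover have "T (s, q) = frame_tube \<gamma> F2 F3 F4 r A B \<epsilon> \<sigma> f g (s, \<phi> (s, q))" if p: "(s, q) \<in> U" for s q
  proof -
    let ?p = "(s, q)"
    let ?x = "\<sigma> * a ?p"
    have \<sigma>2: "\<sigma> * (\<sigma> * z) = z" for z using \<sigma> by auto
    have f_\<phi>: "f (\<phi> ?p) = h ?x" and g_\<phi>: "g (\<phi> ?p) = \<sigma> * b ?p / B (h ?x)"
      by (simp_all add: f_def g_def \<phi>_def)
    have A_x: "A (h ?x) = ?x" and B0: "B (h ?x) \<noteq> 0"
      using h a_J[OF p] by auto
    have "\<epsilon> * (B (h ?x))\<^sup>2 = \<kappa> - ?x\<^sup>2"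
      using AB[of "h ?x"] A_x by simp
    also have "?x\<^sup>2 = (a ?p)\<^sup>2"
      using \<sigma> by auto
    finally have "\<epsilon> * (B (h ?x))\<^sup>2 = 2 * b ?p * c ?p"
      using tubular_quadric[OF p] by simp
    then have "\<epsilon> * B (h ?x) / (2 * g (\<phi> ?p)) = \<sigma> * c ?p"
      using B0 b0[OF p] \<sigma> unfolding g_\<phi> by (auto simp: field_simps power2_eq_square)
    moreover have "g (\<phi> ?p) * B (h ?x) = \<sigma> * b ?p"
      using B0 by (simp add: g_\<phi>)
    ultimately show ?thesis
      unfolding tubular_frame_expansion[OF p] frame_tube_def prod.case f_\<phi> A_x
      by (simp add: scaleR_add_right \<sigma>2 mult.assoc mult.left_commute[of r \<sigma>])
  qed
  ultimately show ?thesis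
    unfolding parametrized_by_def using \<sigma> coeff by blast
qed

end

end

text \<open>A value \<open>a\<close> with \<open>a\<^sup>2 > 1\<close> may lie above \<open>1\<close> or below \<open>- 1\<close>, whereas \<open>cosh\<close> reaches only the
former. On a connected domain the two cases cannot both occur, so that one sign serves for all points.\<close>

lemma connected_image_outside_unit_interval:
  fixes a :: "'a::topological_space \<Rightarrow> real"
  assumes "connected U" "continuous_on U a" "\<And>p. p \<in> U \<Longrightarrow> 1 < (a p)\<^sup>2"
  obtains \<sigma> :: real where "\<sigma> \<in> {1, - 1}" "\<And>p. p \<in> U \<Longrightarrow> 1 < \<sigma> * a p"
proof -
  have abs: "1 < \<bar>a p\<bar>" if "p \<in> U" for p
    using assms(3)[OF that] abs_square_le_1[of "a p"] by linarith
  have conn: "connected (a ` U)"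
    using assms by (intro connected_continuous_image)
  have "\<not> (p \<in> U \<and> q \<in> U \<and> a p < 0 \<and> a q > 0)" for p q
  proof
    assume "p \<in> U \<and> q \<in> U \<and> a p < 0 \<and> a q > 0"
    then have "0 \<in> a ` U"
      using connectedD_interval[OF conn, of "a p" "a q" 0] by auto
    then show False using abs by force
  qed
  then have "(\<forall>p\<in>U. 1 < a p) \<or> (\<forall>p\<in>U. 1 < - a p)"
    using abs by (smt (verit))
  then show thesis
    using that[of 1] that[of "- 1"] by auto
qed

theorem theorem9:
  fixes I :: "real set" and \<gamma> F1 F2 F3 F4 :: "real \<Rightarrow> real ^ 4"
    and k1 k2 k3 :: "real \<Rightarrow> real" and r :: real
  assumes "partially_null_curve I \<gamma> F1 F2 F3 F4 k1 k2 k3"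
    and "r > 0"
  shows
    "(\<forall>D f g \<sigma>. coefficient_functions D f g \<and> \<sigma> \<in> {1, - 1} \<longrightarrow>
        tubular_hypersurface pseudo_hypersphere I \<gamma> r (I \<times> D) (T1 \<gamma> F2 F3 F4 r \<sigma> f g) \<and>
        tubular_hypersurface pseudo_hypersphere I \<gamma> r (I \<times> D) (T2 \<gamma> F2 F3 F4 r \<sigma> f g) \<and>
        tubular_hypersurface pseudo_hypersphere I \<gamma> r (I \<times> D) (T3 \<gamma> F2 F3 F4 r \<sigma> f g) \<and>
        tubular_hypersurface pseudo_hyperbolic_hypersphere I \<gamma> r (I \<times> D) (T4 \<gamma> F2 F3 F4 r \<sigma> f g))
     \<and>
     (\<forall>U T. tubular_hypersurface pseudo_hypersphere I \<gamma> r U T \<longrightarrow>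
        ((\<forall>(s, t, w)\<in>U. lprod (T (s, t, w) - \<gamma> s) (F3 s) * lprod (T (s, t, w) - \<gamma> s) (F4 s) > 0)
           \<longrightarrow> parametrized_by U T (T1 \<gamma> F2 F3 F4 r) \<and> parametrized_by U T (T2 \<gamma> F2 F3 F4 r)) \<and>
        (connected U \<and>
         (\<forall>(s, t, w)\<in>U. lprod (T (s, t, w) - \<gamma> s) (F3 s) * lprod (T (s, t, w) - \<gamma> s) (F4 s) < 0)
           \<longrightarrow> parametrized_by U T (T3 \<gamma> F2 F3 F4 r)))
     \<and>
     (\<forall>U T. tubular_hypersurface pseudo_hyperbolic_hypersphere I \<gamma> r U T \<longrightarrow>
        parametrized_by U T (T4 \<gamma> F2 F3 F4 r))"
proof -
  interpret partially_null_frame I \<gamma> F1 F2 F3 F4 k1 k2 k3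
    using assms(1) by unfold_locales
  have sphere: "u \<in> pseudo_hypersphere p r \<longleftrightarrow> lprod (u - p) (u - p) = 1 * r\<^sup>2" for u p
    by (simp add: pseudo_hypersphere_def)
  have hyperbolic: "u \<in> pseudo_hyperbolic_hypersphere p r \<longleftrightarrow> lprod (u - p) (u - p) = - 1 * r\<^sup>2" for u p
    by (simp add: pseudo_hyperbolic_hypersphere_def)
  have trig: "(sin x)\<^sup>2 + 1 * (cos x)\<^sup>2 = 1" "(cos x)\<^sup>2 + 1 * (sin x)\<^sup>2 = 1"
    "(cosh x)\<^sup>2 + - 1 * (sinh x)\<^sup>2 = 1" "(sinh x)\<^sup>2 + - 1 * (cosh x)\<^sup>2 = - 1" for x :: real
    by (simp_all add: cosh_square_eq)
  have tubes: "tubular_hypersurface pseudo_hypersphere I \<gamma> r (I \<times> D) (T1 \<gamma> F2 F3 F4 r \<sigma> f g)"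
    "tubular_hypersurface pseudo_hypersphere I \<gamma> r (I \<times> D) (T2 \<gamma> F2 F3 F4 r \<sigma> f g)"
    "tubular_hypersurface pseudo_hypersphere I \<gamma> r (I \<times> D) (T3 \<gamma> F2 F3 F4 r \<sigma> f g)"
    "tubular_hypersurface pseudo_hyperbolic_hypersphere I \<gamma> r (I \<times> D) (T4 \<gamma> F2 F3 F4 r \<sigma> f g)"
    if "coefficient_functions D f g" "\<sigma> \<in> {1, - 1}" for D f g \<sigma>
    unfolding T1_eq_frame_tube T2_eq_frame_tube T3_eq_frame_tube T4_eq_frame_tube
    by (rule frame_tube_tubular[where Q = pseudo_hypersphere and r = r, OF sphere smooth_on_sin_cos trig(1) that]
        frame_tube_tubular[where Q = pseudo_hypersphere and r = r, OF sphere smooth_on_sin_cos(2,1) trig(2) that]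
        frame_tube_tubular[where Q = pseudo_hypersphere and r = r, OF sphere smooth_on_sinh_cosh(2,1) trig(3) that]
        frame_tube_tubular[where Q = pseudo_hyperbolic_hypersphere and r = r, OF hyperbolic smooth_on_sinh_cosh trig(4) that])+
  have spheres: "((\<forall>(s, t, w)\<in>U. lprod (T (s, t, w) - \<gamma> s) (F3 s) * lprod (T (s, t, w) - \<gamma> s) (F4 s) > 0)
           \<longrightarrow> parametrized_by U T (T1 \<gamma> F2 F3 F4 r) \<and> parametrized_by U T (T2 \<gamma> F2 F3 F4 r)) \<and>
        (connected U \<and>
         (\<forall>(s, t, w)\<in>U. lprod (T (s, t, w) - \<gamma> s) (F3 s) * lprod (T (s, t, w) - \<gamma> s) (F4 s) < 0)
           \<longrightarrow> parametrized_by U T (T3 \<gamma> F2 F3 F4 r))"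
    if tube: "tubular_hypersurface pseudo_hypersphere I \<gamma> r U T" for U T
  proof -
    let ?a = "normal_coordinate T r F2" and ?b = "normal_coordinate T r F4" and ?c = "normal_coordinate T r F3"
    note quadric = tubular_quadric[where Q = pseudo_hypersphere, OF sphere assms(2) tube]
    note sign = null_product_sign[where Q = pseudo_hypersphere, OF sphere assms(2) tube]
    note parametrized = tubular_parametrized_by_frame_tube[where Q = pseudo_hypersphere, OF sphere assms(2) tube]
    show ?thesis
    proof (intro conjI impI)
      assume pos: "\<forall>(s, t, w)\<in>U. lprod (T (s, t, w) - \<gamma> s) (F3 s) * lprod (T (s, t, w) - \<gamma> s) (F4 s) > 0"
      have bc: "0 < ?b p * ?c p" if "p \<in> U" for p
        using pos that unfolding sign by (cases p) auto
      have a1: "1 * ?a p \<in> {-1<..<1}" and b0: "?b p \<noteq> 0" if "p \<in> U" for p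
        using quadric[OF that] bc[OF that] abs_square_less_1[of "?a p"] by (auto simp: abs_less_iff)
      have cos0: "cos (arcsin x) \<noteq> 0" if "x \<in> {-1<..<1}" for x
        using that by (auto simp: cos_arcsin_nonzero)
      show "parametrized_by U T (T1 \<gamma> F2 F3 F4 r)"
        unfolding T1_eq_frame_tube
        by (rule parametrized[OF smooth_on_sin_cos(2) trig(1) _ smooth_on_arcsin _ cos0 _ a1 b0]) auto
      \<comment> \<open>\<open>pi / 2 - arcsin\<close> is \<open>arccos\<close>, written so that its smoothness is that of \<open>arcsin\<close>.\<close>
      show "parametrized_by U T (T2 \<gamma> F2 F3 F4 r)"
        unfolding T2_eq_frame_tube
      proof (rule parametrized[OF smooth_on_sin_cos(1) trig(2) _ _ _ _ _ a1 b0])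
        show "smooth_on {-1<..<1} (\<lambda>x. pi / 2 - arcsin x)"
          by (intro smooth_on_diff smooth_on_const smooth_on_arcsin) auto
        show "cos (pi / 2 - arcsin x) = x" "sin (pi / 2 - arcsin x) \<noteq> 0" if "x \<in> {-1<..<1}" for x
          using that cos0[OF that] by (auto simp: cos_diff sin_diff)
      qed auto
    next
      assume neg: "connected U \<and>
        (\<forall>(s, t, w)\<in>U. lprod (T (s, t, w) - \<gamma> s) (F3 s) * lprod (T (s, t, w) - \<gamma> s) (F4 s) < 0)"
      have bc: "?b p * ?c p < 0" if "p \<in> U" for p
        using neg that unfolding sign by (cases p) auto
      have b0: "?b p \<noteq> 0" if "p \<in> U" for p
        using bc[OF that] by auto
      have "1 < (?a p)\<^sup>2" if "p \<in> U" for p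
        using quadric[OF that] bc[OF that] by simp
      moreover have "continuous_on U ?a"
        using smooth_on_continuous_on smooth_frame(2)
          smooth_normal_coordinate[where Q = pseudo_hypersphere, OF sphere assms(2) tube] by blast
      ultimately obtain \<sigma> :: real where \<sigma>: "\<sigma> \<in> {1, - 1}" and a1: "\<And>p. p \<in> U \<Longrightarrow> 1 < \<sigma> * ?a p"
        using connected_image_outside_unit_interval[OF conjunct1[OF neg], of ?a] by blast
      show "parametrized_by U T (T3 \<gamma> F2 F3 F4 r)"
        unfolding T3_eq_frame_tube
        by (rule parametrized[OF smooth_on_sinh_cosh(1) trig(3) _ smooth_on_arcosh _ _ \<sigma> _ b0])
           (use a1 in \<open>auto simp: sinh_arcosh_real power2_eq_1_iff\<close>)
    qed
  qed
  have hyperbolics: "parametrized_by U T (T4 \<gamma> F2 F3 F4 r)"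
    if tube: "tubular_hypersurface pseudo_hyperbolic_hypersphere I \<gamma> r U T" for U T
  proof -
    let ?a = "normal_coordinate T r F2" and ?b = "normal_coordinate T r F4"
    have "?b p \<noteq> 0" if "p \<in> U" for p
    proof
      assume "?b p = 0"
      then have "(?a p)\<^sup>2 = - 1"
        using tubular_quadric[where Q = pseudo_hyperbolic_hypersphere, OF hyperbolic assms(2) tube that] by simp
      then show False using zero_le_power2[of "?a p"] by linarith
    qed
    then show ?thesis
      unfolding T4_eq_frame_tube
      by (intro tubular_parametrized_by_frame_tube[where Q = pseudo_hyperbolic_hypersphere and \<sigma> = 1,
            OF hyperbolic assms(2) tube smooth_on_sinh_cosh(2) trig(4) open_UNIV smooth_on_arsinh]) auto
  qed
  show ?thesis
    by (rule conjI[OF _ conjI]; intro allI impI; (elim conjE)?;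
        (rule spheres hyperbolics | intro conjI tubes); assumption)
qed

end
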